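(* Let $N\ge 1$, $T>0$, and let $C=[c_{ij}]_{i,j=1}^N\colon\mathbb{R}\to\mathbb{R}^{N\times N}$ be a continuous, $T$-periodic matrix function such that for each $t\in\mathbb{R}$ all off-diagonal entries of $C(t)$ are positive. Let $\Lambda$ be the principal Lyapunov exponent of the linear system $\frac{du}{dt}=C(t)u$. Let $C_{\mathrm{min}}$ (respectively $C_{\mathrm{max}}$) be the $N\times N$ matrix whose $(i,j)$-entry equals $\min_{t\in[0,T]}c_{ij}(t)$ (respectively $\max_{t\in[0,T]}c_{ij}(t)$). Then $$\lambda_{\mathrm{dom}}(C_{\mathrm{min}})\ \le\ \Lambda\ \le\ \lambda_{\mathrm{dom}}(C_{\mathrm{max}}).$$
   Context: For a real $N\times N$ matrix $A$ with all off-diagonal entries positive, $\lambda_{\mathrm{dom}}(A)$ (the dominant eigenvalue) denotes the eigenvalue of $A$ with the largest real part; it is real and simple. For a continuous $T$-periodic matrix function $C\colon\mathbb{R}\to\mathbb{R}^{N\times N}$ let $U(t;s)$ denote the transition matrix of $\frac{du}{dt}=C(t)u$: $U(t;s)u_0$ is the value at time $t$ of the solution $u$ with $u(s)=u_0$. If all off-diagonal entries of $C(t)$ are positive for every $t$ (the system is then called strongly cooperative), the matrix $U(T;0)$ has all entries positive, and its spectral radius $\rho$ is a positive simple eigenvalue. The principal Lyapunov exponent of the system is $\Lambda:=\frac{\ln\rho}{T}$; it equals $\lim_{t\to\infty}\frac1t\ln\|U(t;0)\|$. *)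

theory Defs
  imports "HOL-Analysis.Analysis"
begin

text \<open>Eigenvalues of a real matrix are complex numbers: the matrix is read over the complex field.\<close>

definition eigenvalues :: "real ^ 'n ^ 'n \<Rightarrow> complex set" where
  "eigenvalues A =
     {\<mu>. \<exists>v :: complex ^ 'n. v \<noteq> 0 \<and> map_matrix complex_of_real A *v v = \<mu> *s v}"

definition spectral_radius :: "real ^ 'n ^ 'n \<Rightarrow> real" where
  "spectral_radius A = Max (cmod ` eigenvalues A)"

text \<open>The real number that is itself an eigenvalue and whose value is the largest real part of all
  eigenvalues. At most one number has this property; by Perron-Frobenius one exists when all
  off-diagonal entries of the matrix are positive.\<close>

definition lambda_dom :: "real ^ 'n ^ 'n \<Rightarrow> real" where
  "lambda_dom A =
     (THE r. complex_of_real r \<in> eigenvalues A \<and> (\<forall>\<mu>\<in>eigenvalues A. Re \<mu> \<le> r))"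

definition positive_off_diagonal :: "real ^ 'n ^ 'n \<Rightarrow> bool" where
  "positive_off_diagonal A \<longleftrightarrow> (\<forall>i j. i \<noteq> j \<longrightarrow> A $ i $ j > 0)"

definition linear_ode_solution ::
    "(real \<Rightarrow> real ^ 'n ^ 'n) \<Rightarrow> (real \<Rightarrow> real ^ 'n) \<Rightarrow> bool" where
  "linear_ode_solution C u \<longleftrightarrow> (\<forall>t. (u has_vector_derivative C t *v u t) (at t))"

text \<open>For continuous \<open>C\<close> the solution with a given value at \<open>s\<close> exists on the whole real line
  and is unique, so the description below denotes it.\<close>

definition transition_matrix ::
    "(real \<Rightarrow> real ^ 'n ^ 'n) \<Rightarrow> real \<Rightarrow> real \<Rightarrow> real ^ 'n ^ 'n" where
  "transition_matrix C t s =
     matrix (\<lambda>u0. (THE u. linear_ode_solution C u \<and> u s = u0) t)"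

definition principal_lyapunov_exponent ::
    "(real \<Rightarrow> real ^ 'n ^ 'n) \<Rightarrow> real \<Rightarrow> real" where
  "principal_lyapunov_exponent C T = ln (spectral_radius (transition_matrix C T 0)) / T"

text \<open>\<open>LEAST\<close> and \<open>GREATEST\<close> over the set of attained values are genuine minima and maxima;
  they exist for continuous \<open>C\<close> and nonnegative \<open>T\<close>. (\<open>Min\<close> and \<open>Max\<close> are
  only meaningful for finite sets.)\<close>

definition C_min :: "(real \<Rightarrow> real ^ 'n ^ 'n) \<Rightarrow> real \<Rightarrow> real ^ 'n ^ 'n" where
  "C_min C T = (\<chi> i j. LEAST c. c \<in> (\<lambda>t. C t $ i $ j) ` {0..T})"

definition C_max :: "(real \<Rightarrow> real ^ 'n ^ 'n) \<Rightarrow> real \<Rightarrow> real ^ 'n ^ 'n" where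
  "C_max C T = (\<chi> i j. GREATEST c. c \<in> (\<lambda>t. C t $ i $ j) ` {0..T})"

end

theory Submission
  imports Defs "HOL-Computational_Algebra.Polynomial"
begin

text \<open>Let \<open>P = U(T;0)\<close>, with Perron vector \<open>y > 0\<close> and spectral radius \<open>\<rho>\<close>, and let \<open>x > 0\<close> be the Perron vector
  of the minimal matrix, with eigenvalue \<open>m\<close>. As \<open>x \<ge> 0\<close>, one has \<open>m x \<le> C(t) x\<close> for all
  \<open>t \<in> [0,T]\<close>, so \<open>e\<^sup>m\<^sup>t x\<close> is a subsolution of the cooperative system. The comparison principle
  (\<open>differential_inequality_nonneg\<close>, \<open>exp_le_solution\<close>) turns this into \<open>e\<^sup>m\<^sup>T x \<le> P x\<close>, and comparing \<open>x\<close>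
  with a multiple of \<open>y\<close> (\<open>collatz_wielandt\<close>) yields \<open>e\<^sup>m\<^sup>T \<le> \<rho>\<close>. The upper bound is symmetric: the
  Perron vector \<open>z\<close> of the maximal matrix, with eigenvalue \<open>M\<close>, satisfies \<open>P z \<le> e\<^sup>M\<^sup>T z\<close>, hence
  \<open>\<rho> \<le> e\<^sup>M\<^sup>T\<close>. Taking logarithms and dividing by \<open>T\<close> gives the claim.

  Two groups of facts give these objects their meaning. Perron vectors come from Brouwer's fixed point
  theorem (\<open>perron_vector_exists\<close>), and \<open>collatz_wielandt\<close> shows that the eigenvalue of a positive
  eigenvector is the spectral radius of a nonnegative matrix and the dominant eigenvalue of a
  cooperative one (\<open>spectral_radius_eqI\<close>, \<open>lambda_dom_eqI\<close>). The transition matrix is determined by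
  existence and uniqueness of solutions (\<open>transition_matrix_works\<close>), and it is strongly positive
  because each positive component of a solution drives all others
  (\<open>transition_matrix_strongly_positive\<close>).\<close>

section \<open>Spectral bounds from positive test vectors\<close>

lemma mult_vec_component: "(A *v x) $ i = (\<Sum>j\<in>UNIV. A $ i $ j * x $ j)"
  by (simp add: matrix_vector_mult_def)

text \<open>Compare \<open>v\<close> with the smallest multiple \<open>q y\<close> that lies above it. The two vectors agree in some
  component \<open>i\<close>, and there \<open>c v\<^sub>i \<le> (A v)\<^sub>i \<le> q (A y)\<^sub>i \<le> r q y\<^sub>i = r v\<^sub>i\<close>. Applied to different pairs
  \<open>(v, y)\<close>, this one inequality gives both the identification of spectral radii and the final estimates.\<close>

lemma collatz_wielandt:
  fixes A :: "real ^ 'n ^ 'n"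
  assumes A: "\<And>i j. 0 \<le> A $ i $ j"
    and v: "0 \<le> v" "v \<noteq> 0" "c *\<^sub>R v \<le> A *v v"
    and y: "\<And>i. 0 < y $ i" "A *v y \<le> r *\<^sub>R y"
  shows "c \<le> r"
proof -
  define q where "q = Max (range (\<lambda>i. v $ i / y $ i))"
  have "q \<in> range (\<lambda>i. v $ i / y $ i)"
    unfolding q_def by (rule Max_in) auto
  then obtain i where i: "q = v $ i / y $ i" by auto
  have vq: "v $ j \<le> q * y $ j" for j
  proof -
    have "v $ j / y $ j \<le> q"
      unfolding q_def by (rule Max_ge) auto
    then show ?thesis using y(1)[of j] by (simp add: field_simps)
  qed
  obtain k where "v $ k \<noteq> 0" using v(2) by (auto simp: vec_eq_iff)
  then have "0 < v $ k" using v(1) by (simp add: less_eq_vec_def order_less_le)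
  then have "0 < q * y $ k" using vq[of k] by simp
  then have q: "0 < q" using y(1)[of k] by (simp add: zero_less_mult_iff)
  have vi: "v $ i = q * y $ i" using i y(1)[of i] by simp
  have "c * v $ i \<le> (\<Sum>j\<in>UNIV. A $ i $ j * v $ j)"
    using v(3) by (simp add: less_eq_vec_def mult_vec_component)
  also have "\<dots> \<le> (\<Sum>j\<in>UNIV. A $ i $ j * (q * y $ j))"
    by (intro sum_mono mult_left_mono vq A)
  also have "\<dots> = q * (A *v y) $ i"
    by (simp add: mult_vec_component sum_distrib_left ac_simps)
  also have "\<dots> \<le> q * (r * y $ i)"
    using y(2) q by (intro mult_left_mono) (auto simp: less_eq_vec_def)
  finally have "c * (q * y $ i) \<le> r * (q * y $ i)" by (simp add: vi ac_simps)
  then show ?thesis using q y(1)[of i] by simp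
qed

lemma of_real_eigenvalue:
  fixes A :: "real ^ 'n ^ 'n"
  assumes "A *v x = r *\<^sub>R x" "x \<noteq> 0"
  shows "complex_of_real r \<in> eigenvalues A"
proof -
  let ?z = "(\<chi> i. complex_of_real (x $ i)) :: complex ^ 'n"
  have "map_matrix complex_of_real A *v ?z = complex_of_real r *s ?z"
    using arg_cong[OF assms(1), of "\<lambda>w. complex_of_real (w $ _)"]
    by (simp add: vec_eq_iff mult_vec_component)
  moreover have "?z \<noteq> 0" using assms(2) by (auto simp: vec_eq_iff)
  ultimately show ?thesis unfolding eigenvalues_def by blast
qed

text \<open>Adding a large multiple of the identity makes a matrix with nonnegative off-diagonal entries
  nonnegative, at the price of a translation of the spectrum.\<close>

lemma eigenvalue_shift:
  fixes A :: "real ^ 'n ^ 'n"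
  assumes "\<mu> \<in> eigenvalues A"
  shows "\<mu> + complex_of_real k \<in> eigenvalues (A + k *\<^sub>R mat 1)"
proof -
  obtain v where v: "v \<noteq> 0" "map_matrix complex_of_real A *v v = \<mu> *s v"
    using assms by (auto simp: eigenvalues_def)
  have "map_matrix complex_of_real (A + k *\<^sub>R mat 1)
        = map_matrix complex_of_real A + mat (complex_of_real k)"
    by (simp add: vec_eq_iff mat_def)
  moreover have "mat (complex_of_real k) *v v = complex_of_real k *s v"
    by (simp add: vec_eq_iff mult_vec_component mat_def if_distrib[of "\<lambda>a. a * _"] cong: if_cong)
  ultimately have "map_matrix complex_of_real (A + k *\<^sub>R mat 1) *v v
      = (\<mu> + complex_of_real k) *s v"
    using v(2) by (simp add: matrix_vector_mult_add_rdistrib vector_sadd_rdistrib)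
  then show ?thesis using v(1) unfolding eigenvalues_def by blast
qed

text \<open>For a complex eigenvector \<open>v\<close> the triangle inequality gives \<open>\<bar>\<mu>\<bar> \<bar>v\<bar> \<le> A \<bar>v\<bar>\<close> entrywise, so that
  \<open>\<bar>v\<bar>\<close> can play the role of the lower test vector.\<close>

lemma cmod_eigenvalue_le:
  fixes A :: "real ^ 'n ^ 'n"
  assumes A: "\<And>i j. 0 \<le> A $ i $ j"
    and y: "\<And>i. 0 < y $ i" "A *v y \<le> r *\<^sub>R y"
    and \<mu>: "\<mu> \<in> eigenvalues A"
  shows "cmod \<mu> \<le> r"
proof -
  obtain v where v: "v \<noteq> 0" "map_matrix complex_of_real A *v v = \<mu> *s v"
    using \<mu> by (auto simp: eigenvalues_def)
  define w where "w = (\<chi> i. cmod (v $ i))"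
  have "cmod \<mu> *\<^sub>R w \<le> A *v w"
  proof (simp add: less_eq_vec_def, intro allI)
    fix i
    have "cmod \<mu> * w $ i = cmod ((\<mu> *s v) $ i)"
      by (simp add: w_def norm_mult)
    also have "\<dots> = cmod (\<Sum>j\<in>UNIV. complex_of_real (A $ i $ j) * v $ j)"
      unfolding v(2)[symmetric] by (simp add: mult_vec_component)
    also have "\<dots> \<le> (\<Sum>j\<in>UNIV. cmod (complex_of_real (A $ i $ j) * v $ j))"
      by (rule norm_sum)
    also have "\<dots> = (A *v w) $ i"
      using A by (simp add: mult_vec_component w_def norm_mult)
    finally show "cmod \<mu> * w $ i \<le> (A *v w) $ i" .
  qed
  moreover have "0 \<le> w" by (simp add: w_def less_eq_vec_def)
  moreover have "w \<noteq> 0" using v(1) by (auto simp: w_def vec_eq_iff)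
  ultimately show ?thesis using collatz_wielandt[OF A _ _ _ y] by blast
qed

text \<open>Only real parts can be controlled here: the bound \<open>\<bar>\<mu> + k\<bar> \<le> r + k\<close> holds for the shifted matrix,
  and a disc of radius \<open>r + k\<close> centred at \<open>-k\<close> lies to the left of the line \<open>Re = r\<close>.\<close>

lemma Re_eigenvalue_le:
  fixes A :: "real ^ 'n ^ 'n"
  assumes A: "\<And>i j. i \<noteq> j \<Longrightarrow> 0 \<le> A $ i $ j"
    and y: "\<And>i. 0 < y $ i" "A *v y \<le> r *\<^sub>R y"
    and \<mu>: "\<mu> \<in> eigenvalues A"
  shows "Re \<mu> \<le> r"
proof -
  define k where "k = (\<Sum>i\<in>UNIV. \<bar>A $ i $ i\<bar>)"
  have k: "- A $ i $ i \<le> k" for i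
  proof -
    have "\<bar>A $ i $ i\<bar> \<le> k"
      unfolding k_def by (rule member_le_sum) auto
    then show ?thesis by linarith
  qed
  let ?B = "A + k *\<^sub>R mat 1"
  have "0 \<le> ?B $ i $ j" for i j
    using k[of i] A[of i j] by (auto simp: mat_def)
  moreover have "?B *v y \<le> (r + k) *\<^sub>R y"
    using y(2) by (simp add: matrix_vector_mult_add_rdistrib scaleR_matrix_vector_assoc[symmetric]
        less_eq_vec_def algebra_simps)
  ultimately have "cmod (\<mu> + complex_of_real k) \<le> r + k"
    using cmod_eigenvalue_le[OF _ y(1) _ eigenvalue_shift[OF \<mu>]] by blast
  then show ?thesis using complex_Re_le_cmod[of "\<mu> + complex_of_real k"] by simp
qed

lemma lambda_dom_eqI:
  fixes A :: "real ^ 'n ^ 'n"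
  assumes "\<And>i j. i \<noteq> j \<Longrightarrow> 0 \<le> A $ i $ j"
    and "\<And>i. 0 < x $ i" "A *v x = r *\<^sub>R x"
  shows "lambda_dom A = r"
proof -
  have "x \<noteq> 0" using assms(2)[of undefined] by auto
  then have r: "complex_of_real r \<in> eigenvalues A"
    by (rule of_real_eigenvalue[OF assms(3)])
  have le: "\<forall>\<mu>\<in>eigenvalues A. Re \<mu> \<le> r"
    using Re_eigenvalue_le[OF assms(1,2)] assms(3) by auto
  show ?thesis
    unfolding lambda_dom_def
  proof (rule the_equality)
    show "complex_of_real r \<in> eigenvalues A \<and> (\<forall>\<mu>\<in>eigenvalues A. Re \<mu> \<le> r)"
      using r le by blast
  next
    fix s
    assume "complex_of_real s \<in> eigenvalues A \<and> (\<forall>\<mu>\<in>eigenvalues A. Re \<mu> \<le> s)"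
    then show "s = r" using r le by (force intro: antisym)
  qed
qed

text \<open>The eigenvalues are the roots of the characteristic polynomial. It is not the zero polynomial because
  the eigenvalues are bounded by the operator norm. Finiteness is what makes the maximum in the
  definition of the spectral radius meaningful.\<close>

lemma finite_eigenvalues:
  fixes A :: "real ^ 'n ^ 'n"
  shows "finite (eigenvalues A)"
proof -
  let ?A = "map_matrix complex_of_real A"
  define p where "p = det ((\<chi> i j. [:complex_of_real (A $ i $ j):]
                              - (if i = j then [:0, 1:] else 0)) :: complex poly ^ 'n ^ 'n)"
  have p: "poly p \<mu> = det (?A - mat \<mu>)" for \<mu>
    by (auto simp: p_def det_def poly_sum poly_prod mat_def intro!: sum.cong prod.cong)
  have root: "\<mu> \<in> eigenvalues A \<longleftrightarrow> poly p \<mu> = 0" for \<mu>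
  proof -
    have mat: "mat \<mu> *v v = \<mu> *s v" for v :: "complex ^ 'n"
      by (simp add: vec_eq_iff mult_vec_component mat_def if_distrib[of "\<lambda>a. a * _"] cong: if_cong)
    have "poly p \<mu> = 0 \<longleftrightarrow> \<not> (\<exists>B. B ** (?A - mat \<mu>) = mat 1)"
      unfolding p using invertible_det_nz invertible_left_inverse by blast
    also have "\<dots> \<longleftrightarrow> (\<exists>v. v \<noteq> 0 \<and> (?A - mat \<mu>) *v v = 0)"
      unfolding matrix_left_invertible_ker by blast
    also have "\<dots> \<longleftrightarrow> \<mu> \<in> eigenvalues A"
      by (simp add: eigenvalues_def matrix_vector_mult_diff_rdistrib mat)
    finally show ?thesis by blast
  qed
  have "p \<noteq> 0"
  proof
    assume "p = 0"
    define b where "b = onorm ((*v) ?A)"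
    have b: "0 \<le> b" unfolding b_def by (rule onorm_pos_le) auto
    have "complex_of_real (b + 1) \<in> eigenvalues A" using root \<open>p = 0\<close> by simp
    then obtain v where v: "v \<noteq> 0" "?A *v v = complex_of_real (b + 1) *s v"
      by (auto simp: eigenvalues_def)
    have "norm (?A *v v) = (b + 1) * norm v"
      unfolding v(2) using b by (simp add: norm_vec_def norm_mult L2_set_right_distrib del: of_real_add)
    moreover have "norm (?A *v v) \<le> b * norm v"
      unfolding b_def by (rule onorm) auto
    ultimately show False using v(1) by (simp add: algebra_simps)
  qed
  then have "finite {\<mu>. poly p \<mu> = 0}" by (rule poly_roots_finite)
  moreover have "eigenvalues A = {\<mu>. poly p \<mu> = 0}" using root by blast
  ultimately show ?thesis by simp
qed

lemma spectral_radius_eqI: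
  fixes A :: "real ^ 'n ^ 'n"
  assumes A: "\<And>i j. 0 \<le> A $ i $ j"
    and x: "\<And>i. 0 < x $ i" "A *v x = r *\<^sub>R x"
  shows "spectral_radius A = r"
  unfolding spectral_radius_def
proof (rule Max_eqI)
  show "finite (cmod ` eigenvalues A)" by (simp add: finite_eigenvalues)
  have le: "cmod \<mu> \<le> r" if "\<mu> \<in> eigenvalues A" for \<mu>
    using cmod_eigenvalue_le[OF A x(1) _ that] x(2) by simp
  then show "\<And>m. m \<in> cmod ` eigenvalues A \<Longrightarrow> m \<le> r" by auto
  have "x \<noteq> 0" using x(1)[of undefined] by auto
  then have r: "complex_of_real r \<in> eigenvalues A"
    by (rule of_real_eigenvalue[OF x(2)])
  have "0 \<le> r" using le[OF r] norm_ge_zero[of "complex_of_real r"] by linarith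
  then show "r \<in> cmod ` eigenvalues A" using r by (force intro: image_eqI)
qed

section \<open>Perron vectors\<close>

text \<open>Equivalent to positivity of all entries, but phrased so that it can be read off from the flow of a
  differential equation.\<close>

definition strongly_positive :: "real ^ 'n ^ 'n \<Rightarrow> bool" where
  "strongly_positive A \<longleftrightarrow> (\<forall>x\<ge>0. x \<noteq> 0 \<longrightarrow> (\<forall>i. 0 < (A *v x) $ i))"

lemma strongly_positiveI:
  fixes A :: "real ^ 'n ^ 'n"
  assumes "\<And>i j. 0 < A $ i $ j"
  shows "strongly_positive A"
  unfolding strongly_positive_def
proof (intro allI impI)
  fix x :: "real ^ 'n" and i assume x: "0 \<le> x" "x \<noteq> 0"
  obtain k where "x $ k \<noteq> 0" using x(2) by (auto simp: vec_eq_iff)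
  then have "0 < x $ k" using x(1) by (simp add: less_eq_vec_def order_less_le)
  then show "0 < (A *v x) $ i"
    unfolding mult_vec_component using x(1) assms
    by (intro sum_pos2[of _ k]) (auto simp: less_eq_vec_def less_imp_le)
qed

lemma strongly_positive_entry:
  fixes A :: "real ^ 'n ^ 'n"
  assumes "strongly_positive A"
  shows "0 < A $ i $ j"
proof -
  have "(0 :: real ^ 'n) \<le> axis j 1" by (simp add: less_eq_vec_def axis_def)
  moreover have "axis j 1 \<noteq> (0 :: real ^ 'n)" by (simp add: axis_eq_0_iff)
  ultimately have "0 < (A *v axis j 1) $ i"
    using assms by (simp add: strongly_positive_def)
  then show ?thesis by (simp add: matrix_vector_mult_basis column_def)
qed

text \<open>The map \<open>x \<mapsto> A x / \<Sum>\<^sub>i (A x)\<^sub>i\<close> sends the standard simplex into its relative interior, and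
  a fixed point of it, which exists by Brouwer's theorem, is a positive eigenvector.\<close>

lemma perron_vector_exists:
  fixes A :: "real ^ 'n ^ 'n"
  assumes "strongly_positive A"
  obtains r x where "0 < r" "\<And>i. 0 < x $ i" "A *v x = r *\<^sub>R x"
proof -
  define s :: "real ^ 'n \<Rightarrow> real" where "s x = (\<Sum>i\<in>UNIV. x $ i)" for x
  define S :: "(real ^ 'n) set" where "S = {x. 0 \<le> x \<and> s x = 1}"
  define f where "f x = (1 / s (A *v x)) *\<^sub>R (A *v x)" for x
  have lin: "linear s" by (rule linearI) (auto simp: s_def sum.distrib sum_distrib_left)
  have cont: "continuous_on X s" for X
    using lin by (simp add: linear_continuous_on linear_conv_bounded_linear)
  have pos: "0 < (A *v x) $ i" "0 < s (A *v x)" if "x \<in> S" for x i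
  proof -
    have "x \<noteq> 0" using that by (auto simp: S_def s_def)
    then show *: "0 < (A *v x) $ i" for i
      using assms that by (simp add: strongly_positive_def S_def)
    show "0 < s (A *v x)" unfolding s_def by (rule sum_pos) (auto simp: *)
  qed
  have comp: "x $ i \<le> 1" if "x \<in> S" for x i
  proof -
    have "x $ i \<le> s x"
      unfolding s_def using that by (intro member_le_sum) (auto simp: S_def less_eq_vec_def)
    then show ?thesis using that by (simp add: S_def)
  qed
  have "S = {0..1} \<inter> s -` {1}"
    using comp by (auto simp: S_def less_eq_vec_def)
  moreover have "closed (s -` {1})"
    using continuous_closed_vimage[of "{1}" s] lin
    by (simp add: linear_continuous_at linear_conv_bounded_linear)
  moreover have "compact {0..1 :: real ^ 'n}"
    by (metis compact_cbox interval_cbox)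
  ultimately have "compact S" by (simp add: compact_Int_closed)
  moreover have "convex S"
  proof (rule convexI)
    fix x y :: "real ^ 'n" and u v :: real
    assume "x \<in> S" "y \<in> S" "0 \<le> u" "0 \<le> v" "u + v = 1"
    then show "u *\<^sub>R x + v *\<^sub>R y \<in> S"
      by (simp add: S_def less_eq_vec_def linear_add[OF lin] linear_scale[OF lin])
  qed
  moreover have "axis undefined 1 \<in> S"
    by (simp add: S_def s_def less_eq_vec_def axis_def)
  moreover have "continuous_on S f"
    unfolding f_def
  proof (intro continuous_intros ballI)
    show "continuous_on S (\<lambda>x. s (A *v x))"
      by (rule continuous_on_compose2[OF cont[of UNIV] matrix_vector_mult_linear_continuous_on]) auto
    show "s (A *v x) \<noteq> 0" if "x \<in> S" for x using pos(2)[OF that] by simp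
  qed
  moreover have "f \<in> S \<rightarrow> S"
  proof
    fix x assume x: "x \<in> S"
    show "f x \<in> S"
      using pos[OF x] by (simp add: S_def f_def less_eq_vec_def linear_scale[OF lin] less_imp_le)
  qed
  ultimately obtain x where x: "x \<in> S" "f x = x" using brouwer[of S f] by blast
  have *: "A *v x = s (A *v x) *\<^sub>R x"
    using x(2) pos(2)[OF x(1)] by (simp add: f_def) (metis divide_self_if less_irrefl scaleR_one scaleR_scaleR times_divide_eq_right mult_1_right)
  show thesis
  proof (rule that[OF pos(2)[OF x(1)] _ *])
    fix i
    have "0 < f x $ i" using pos[OF x(1)] by (simp add: f_def)
    then show "0 < x $ i" by (simp add: x(2))
  qed
qed

lemma lambda_dom_eigenvector:
  fixes A :: "real ^ 'n ^ 'n"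
  assumes "positive_off_diagonal A"
  obtains x where "\<And>i. 0 < x $ i" "A *v x = lambda_dom A *\<^sub>R x"
proof -
  define k where "k = 1 + (\<Sum>i\<in>UNIV. \<bar>A $ i $ i\<bar>)"
  have k: "- A $ i $ i < k" for i
  proof -
    have "\<bar>A $ i $ i\<bar> \<le> (\<Sum>i\<in>UNIV. \<bar>A $ i $ i\<bar>)"
      by (rule member_le_sum) auto
    then show ?thesis by (simp add: k_def)
  qed
  have "strongly_positive (A + k *\<^sub>R mat 1)"
  proof (rule strongly_positiveI)
    fix i j
    show "0 < (A + k *\<^sub>R mat 1) $ i $ j"
      using k[of i] assms by (auto simp: mat_def positive_off_diagonal_def)
  qed
  then obtain r x where x: "\<And>i. 0 < x $ i" "(A + k *\<^sub>R mat 1) *v x = r *\<^sub>R x"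
    using perron_vector_exists by metis
  have "A *v x = (r - k) *\<^sub>R x"
    using x(2) by (simp add: matrix_vector_mult_add_rdistrib scaleR_matrix_vector_assoc[symmetric]
        algebra_simps)
  moreover from this have "lambda_dom A = r - k"
    using assms x(1) by (intro lambda_dom_eqI) (auto simp: positive_off_diagonal_def less_imp_le)
  ultimately show thesis using that[OF x(1)] by simp
qed

section \<open>Solutions of linear systems\<close>

lemma bounded_bilinear_mult_vec:
  "bounded_bilinear ((*v) :: real ^ 'n ^ 'm \<Rightarrow> real ^ 'n \<Rightarrow> real ^ 'm)"
proof -
  have "bilinear ((*v) :: real ^ 'n ^ 'm \<Rightarrow> real ^ 'n \<Rightarrow> real ^ 'm)"
    unfolding bilinear_def
    by (auto intro!: linearI simp: matrix_vector_mult_add_rdistrib scaleR_matrix_vector_assoc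
        matrix_vector_right_distrib matrix_vector_mult_scaleR)
  then show ?thesis by (simp add: bilinear_conv_bounded_bilinear)
qed

lemmas continuous_on_mult_vec =
  bounded_bilinear.continuous_on[OF bounded_bilinear_mult_vec]

lemma mult_vec_bounded_on_interval:
  fixes C :: "real \<Rightarrow> real ^ 'n ^ 'n"
  assumes "continuous_on {a..b} C"
  obtains K where "0 < K" "\<And>t x. t \<in> {a..b} \<Longrightarrow> norm (C t *v x) \<le> K * norm x"
proof -
  obtain L where L: "0 < L" "\<And>(M :: real ^ 'n ^ 'n) x. norm (M *v x) \<le> norm M * norm x * L"
    using bounded_bilinear.pos_bounded[OF bounded_bilinear_mult_vec] by metis
  have "bounded (C ` {a..b})"
    by (intro compact_imp_bounded compact_continuous_image assms) auto
  then obtain B where B: "0 < B" "\<And>t. t \<in> {a..b} \<Longrightarrow> norm (C t) \<le> B"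
    by (auto simp: bounded_pos)
  show thesis
  proof (rule that)
    show "0 < B * L" using B L by simp
    fix t x assume t: "t \<in> {a..b}"
    have "norm (C t *v x) \<le> norm (C t) * (norm x * L)"
      using L(2)[of "C t" x] by (simp add: ac_simps)
    also have "\<dots> \<le> B * (norm x * L)"
      using B(2)[OF t] L(1) by (intro mult_right_mono) auto
    finally show "norm (C t *v x) \<le> B * L * norm x" by (simp add: ac_simps)
  qed
qed

lemma antiderivative_exists:
  fixes f :: "real \<Rightarrow> 'a :: euclidean_space"
  assumes "continuous_on UNIV f"
  shows "\<exists>F. F 0 = 0 \<and> (\<forall>t. (F has_vector_derivative f t) (at t))"
proof -
  have "isCont f t" for t using assms by (simp add: continuous_on_eq_continuous_at)
  then obtain G where G: "\<And>t. (G has_vector_derivative f t) (at t)"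
    using einterval_antiderivative[of "-\<infinity>" "\<infinity>" f] by auto
  have "((\<lambda>t. G t - G 0) has_vector_derivative f t) (at t)" for t
    by (auto intro!: derivative_eq_intros G)
  then show ?thesis by (intro exI[of _ "\<lambda>t. G t - G 0"]) auto
qed

text \<open>The induction step of the Picard estimate \<open>\<parallel>g\<^sub>n(t)\<parallel> \<le> b K\<^sup>n \<bar>t\<bar>\<^sup>n / n!\<close>. Negative times
  are reduced to positive ones by reflecting \<open>f\<close>.\<close>

lemma power_bound_integrate:
  fixes f :: "real \<Rightarrow> 'a :: real_normed_vector"
  assumes f: "\<And>s. (f has_vector_derivative f' s) (at s)" "f 0 = 0"
    and bound: "\<And>s. \<bar>s\<bar> \<le> R \<Longrightarrow> norm (f' s) \<le> B * \<bar>s\<bar> ^ n"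
    and t: "\<bar>t\<bar> \<le> R"
  shows "norm (f t) \<le> B * \<bar>t\<bar> ^ Suc n / Suc n"
proof -
  have right: "norm (g r) \<le> B * r ^ Suc n / Suc n"
    if g: "\<And>s. (g has_vector_derivative g' s) (at s)" "g 0 = 0"
      and le: "\<And>s. \<bar>s\<bar> \<le> R \<Longrightarrow> norm (g' s) \<le> B * \<bar>s\<bar> ^ n"
      and r: "0 < r" "r \<le> R" for g g' :: "real \<Rightarrow> 'a" and r
  proof -
    have "norm (g r - g 0) \<le> B * r ^ Suc n / Suc n - B * 0 ^ Suc n / Suc n"
    proof (rule differentiable_bound_general[OF r(1), where f' = g' and \<phi>' = "\<lambda>s. B * s ^ n"])
      show "continuous_on {0..r} g"
        using g(1) by (meson continuous_at_imp_continuous_on has_vector_derivative_continuous)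
      show "continuous_on {0..r} (\<lambda>s. B * s ^ Suc n / Suc n)"
        by (intro continuous_intros) simp
      show "((\<lambda>s. B * s ^ Suc n / Suc n) has_vector_derivative B * s ^ n) (at s)" for s
        unfolding has_real_derivative_iff_has_vector_derivative[symmetric]
        by (auto intro!: derivative_eq_intros simp del: of_nat_Suc power_Suc)
      show "norm (g' s) \<le> B * s ^ n" if "0 < s" "s < r" for s
        using le[of s] that r by auto
    qed (rule g(1))
    then show ?thesis by (simp add: g(2))
  qed
  consider "t = 0" | "0 < t" | "t < 0" by linarith
  then show ?thesis
  proof cases
    case 1
    then show ?thesis by (simp add: f(2))
  next
    case 2
    then show ?thesis using right[OF f bound, of t] t by simp
  next
    case 3
    have "((\<lambda>s. f (- s)) has_vector_derivative - f' (- s)) (at s)" for s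
      using vector_diff_chain_at[OF has_vector_derivative_minus[OF has_vector_derivative_id] f(1), of s]
      by (simp add: o_def)
    then show ?thesis
      using right[of "\<lambda>s. f (- s)" "\<lambda>s. - f' (- s)" "- t"] bound[of "- s" for s] f(2) t 3 by simp
  qed
qed

text \<open>The solution is the Picard (Peano-Baker) series \<open>u = \<Sum>\<^sub>n g\<^sub>n\<close> with \<open>g\<^sub>0 = u0\<close> and \<open>g\<^sub>n\<^sub>+\<^sub>1(t) = \<integral>\<^sub>0\<^sup>t C g\<^sub>n\<close>.
  On every bounded interval it is dominated by an exponential series, so it converges uniformly, and
  so does its termwise derivative \<open>C (g\<^sub>0 + \<dots> + g\<^sub>n)\<close>.\<close>

lemma linear_ode_solution_exists:
  fixes C :: "real \<Rightarrow> real ^ 'n ^ 'n"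
  assumes C: "continuous_on UNIV C"
  shows "\<exists>u. linear_ode_solution C u \<and> u 0 = u0"
proof -
  obtain I :: "(real \<Rightarrow> real ^ 'n) \<Rightarrow> real \<Rightarrow> real ^ 'n" where
    I: "\<And>f. continuous_on UNIV f \<Longrightarrow> I f 0 = 0"
       "\<And>f t. continuous_on UNIV f \<Longrightarrow> (I f has_vector_derivative f t) (at t)"
    using antiderivative_exists by metis
  define g where "g n = ((\<lambda>h. I (\<lambda>t. C t *v h t)) ^^ n) (\<lambda>t. u0)" for n
  \<comment> \<open>The index shift makes the sum of the derivatives of the first \<open>n\<close> terms equal to \<open>C\<close> applied to the sum of the first \<open>n - 1\<close> terms.\<close>
  define g' where "g' n t = (case n of 0 \<Rightarrow> 0 | Suc m \<Rightarrow> C t *v g m t)" for n t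
  have g0: "g 0 = (\<lambda>t. u0)" and gSuc: "g (Suc n) = I (\<lambda>t. C t *v g n t)" for n
    by (simp_all add: g_def)
  have cont: "continuous_on UNIV (g n)" for n
  proof (induction n)
    case (Suc n)
    then show ?case
      unfolding gSuc using I(2)[OF continuous_on_mult_vec[OF C]]
      by (meson continuous_at_imp_continuous_on has_vector_derivative_continuous)
  qed (simp add: g0)
  have gSuc_deriv: "(g (Suc n) has_vector_derivative C t *v g n t) (at t)" for n t
    unfolding gSuc by (rule I(2)[OF continuous_on_mult_vec[OF C cont]])
  have gSuc_0: "g (Suc n) 0 = 0" for n
    unfolding gSuc by (rule I(1)[OF continuous_on_mult_vec[OF C cont]])
  have deriv: "(g n has_vector_derivative g' n t) (at t)" for n t
    by (cases n) (auto simp: g0 g'_def gSuc_deriv)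
  have bound: "norm (g n t) \<le> norm u0 * (K * R) ^ n / fact n"
    if K: "0 < K" "\<And>t x. t \<in> {-R..R} \<Longrightarrow> norm (C t *v x) \<le> K * norm x"
      and t: "\<bar>t\<bar> \<le> R" for K R n t
  proof -
    have "\<bar>t\<bar> \<le> R \<Longrightarrow> norm (g n t) \<le> (norm u0 * K ^ n / fact n) * \<bar>t\<bar> ^ n" for t
    proof (induction n arbitrary: t)
      case (Suc n)
      have "norm (g (Suc n) t) \<le> norm u0 * K ^ Suc n / fact n * \<bar>t\<bar> ^ Suc n / Suc n"
      proof (rule power_bound_integrate[OF gSuc_deriv gSuc_0 _ Suc.prems])
        fix s :: real assume s: "\<bar>s\<bar> \<le> R"
        have "norm (C s *v g n s) \<le> K * norm (g n s)"
          using s by (intro K(2)) auto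
        also have "\<dots> \<le> K * (norm u0 * K ^ n / fact n * \<bar>s\<bar> ^ n)"
          using Suc.IH[OF s] K(1) by (intro mult_left_mono) auto
        finally show "norm (C s *v g n s) \<le> norm u0 * K ^ Suc n / fact n * \<bar>s\<bar> ^ n"
          by (simp add: ac_simps)
      qed
      then show ?case by (simp add: field_simps)
    qed (simp add: g0)
    then have "norm (g n t) \<le> (norm u0 * K ^ n / fact n) * \<bar>t\<bar> ^ n" using t .
    also have "\<dots> \<le> (norm u0 * K ^ n / fact n) * R ^ n"
      using t K(1) by (intro mult_left_mono power_mono) auto
    finally show ?thesis by (simp add: power_mult_distrib)
  qed
  have sm: "summable (\<lambda>n. b * c ^ n / fact n)" for b c :: real
    using summable_mult[OF summable_exp[of c], of b] by (simp add: field_simps)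
  define u where "u t = (\<Sum>n. g n t)" for t
  have "u 0 = u0"
  proof -
    have "g n 0 = (if n = 0 then u0 else 0)" for n
      by (cases n) (auto simp: g0 gSuc_0)
    then show ?thesis using sums_If_finite_set[of "{0}" "\<lambda>_. u0"] by (simp add: u_def sums_iff)
  qed
  moreover have "(u has_vector_derivative C t *v u t) (at t)" for t
  proof -
    \<comment> \<open>The series may be differentiated termwise on a bounded interval around \<open>t\<close>.\<close>
    define R where "R = \<bar>t\<bar> + 1"
    define S where "S = {-R<..<R}"
    have S: "open S" "convex S" "t \<in> S" by (auto simp: S_def R_def)
    have "continuous_on {-R..R} C" using C continuous_on_subset by blast
    then obtain K where K: "0 < K" "\<And>t x. t \<in> {-R..R} \<Longrightarrow> norm (C t *v x) \<le> K * norm x"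
      using mult_vec_bounded_on_interval by metis
    have bd: "norm (g n x) \<le> norm u0 * (K * R) ^ n / fact n" if "x \<in> S" for n x
      using bound[OF K] that by (auto simp: S_def)
    have unif: "uniform_limit S (\<lambda>n x. \<Sum>i<n. g i x) u sequentially"
      unfolding u_def by (rule Weierstrass_m_test[OF bd sm])
    have sums: "(\<lambda>n. g n x) sums u x" if "x \<in> S" for x
      unfolding u_def by (rule summable_sums[OF summable_comparison_test'[OF sm bd[OF that]]])
    have "\<exists>w. \<forall>x\<in>S. (\<lambda>n. g n x) sums w x \<and>
        (w has_derivative (\<lambda>h. h *\<^sub>R (C x *v u x))) (at x within S)"
    proof (rule has_derivative_series[where f = g and f' = "\<lambda>n x h. h *\<^sub>R g' n x"])
      show "(g n has_derivative (\<lambda>h. h *\<^sub>R g' n x)) (at x within S)" for n x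
        using has_vector_derivative_at_within[OF deriv] by (simp add: has_vector_derivative_def)
      fix e :: real assume e: "0 < e"
      have "\<forall>\<^sub>F n in sequentially. \<forall>x\<in>S. dist (\<Sum>i<n. g i x) (u x) < e / K"
        using uniform_limitD[OF unif] e K(1) by simp
      then have "\<forall>\<^sub>F n in sequentially. \<forall>x\<in>S. dist (\<Sum>i<n - 1. g i x) (u x) < e / K"
        unfolding eventually_sequentially by (metis Suc_le_D Suc_le_mono diff_Suc_1)
      then show "\<forall>\<^sub>F n in sequentially. \<forall>x\<in>S. \<forall>h.
          norm ((\<Sum>i<n. h *\<^sub>R g' i x) - h *\<^sub>R (C x *v u x)) \<le> e * norm h"
      proof (rule eventually_mono[OF eventually_conj[OF eventually_gt_at_top[of 0]]], intro ballI allI)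
        fix n x h
        assume n: "0 < n \<and> (\<forall>x\<in>S. dist (\<Sum>i<n - 1. g i x) (u x) < e / K)" and x: "x \<in> S"
        obtain m where m: "n = Suc m" using n by (cases n) auto
        have "(\<Sum>i<n. h *\<^sub>R g' i x) - h *\<^sub>R (C x *v u x)
            = h *\<^sub>R (C x *v ((\<Sum>i<m. g i x) - u x))"
          unfolding m sum.lessThan_Suc_shift
          by (simp add: g'_def matrix_vector_mult_diff_distrib linear_sum[OF matrix_vector_mul_linear]
              scaleR_sum_right scaleR_diff_right)
        then have "norm ((\<Sum>i<n. h *\<^sub>R g' i x) - h *\<^sub>R (C x *v u x))
            = \<bar>h\<bar> * norm (C x *v ((\<Sum>i<m. g i x) - u x))" by simp
        also have "\<dots> \<le> \<bar>h\<bar> * (K * norm ((\<Sum>i<m. g i x) - u x))"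
          using x by (intro mult_left_mono K(2)) (auto simp: S_def)
        also have "\<dots> \<le> \<bar>h\<bar> * (K * (e / K))"
          using n x m K(1) by (intro mult_left_mono) (auto simp: dist_norm less_imp_le)
        finally show "norm ((\<Sum>i<n. h *\<^sub>R g' i x) - h *\<^sub>R (C x *v u x)) \<le> e * norm h"
          using K(1) by (simp add: ac_simps)
      qed
    qed (use S sums in auto)
    then obtain w where w: "\<And>x. x \<in> S \<Longrightarrow> (\<lambda>n. g n x) sums w x"
        "(w has_vector_derivative C t *v u t) (at t within S)"
      using S(3) by (auto simp: has_vector_derivative_def)
    have "(w has_vector_derivative C t *v u t) (at t)"
      using w(2) unfolding at_within_open[OF S(3,1)] .
    moreover have "w x = u x" if "x \<in> S" for x
      by (rule sums_unique2[OF w(1)[OF that] sums[OF that]])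
    ultimately show ?thesis
      by (rule has_vector_derivative_transform_within_open[OF _ S(1,3)])
  qed
  ultimately show ?thesis unfolding linear_ode_solution_def by blast
qed

text \<open>Gronwall's argument: \<open>\<parallel>u\<parallel>\<^sup>2\<close> changes at a relative rate of at most \<open>2K\<close>, so
  \<open>e\<^sup>-\<^sup>2\<^sup>K\<^sup>t \<parallel>u\<parallel>\<^sup>2\<close> decreases to the right of \<open>0\<close> and \<open>e\<^sup>2\<^sup>K\<^sup>t \<parallel>u\<parallel>\<^sup>2\<close> increases to the left of it.\<close>

lemma linear_ode_solution_zero:
  fixes C :: "real \<Rightarrow> real ^ 'n ^ 'n"
  assumes C: "continuous_on UNIV C" and u: "linear_ode_solution C u" "u 0 = 0"
  shows "u t = 0"
proof -
  have "continuous_on {-\<bar>t\<bar>..\<bar>t\<bar>} C" using C continuous_on_subset by blast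
  then obtain K where K: "0 < K" "\<And>s x. s \<in> {-\<bar>t\<bar>..\<bar>t\<bar>} \<Longrightarrow> norm (C s *v x) \<le> K * norm x"
    using mult_vec_bounded_on_interval by metis
  define E where "E a s = exp (a * s) * (u s \<bullet> u s)" for a s
  have E: "(E a has_real_derivative exp (a * s) * (a * (u s \<bullet> u s) + 2 * (u s \<bullet> (C s *v u s)))) (at s)"
    for a s
  proof -
    have us: "(u has_vector_derivative C s *v u s) (at s)"
      using u(1) by (simp add: linear_ode_solution_def)
    have "((\<lambda>s. u s \<bullet> u s) has_real_derivative 2 * (u s \<bullet> (C s *v u s))) (at s)"
      using has_derivative_inner[OF us[unfolded has_vector_derivative_def] us[unfolded has_vector_derivative_def]]
      by (simp add: has_field_derivative_def inner_commute algebra_simps mult_commute_abs)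
    then show ?thesis
      unfolding E_def by (auto intro!: derivative_eq_intros simp: algebra_simps)
  qed
  have inner: "\<bar>u s \<bullet> (C s *v u s)\<bar> \<le> K * (u s \<bullet> u s)" if "s \<in> {-\<bar>t\<bar>..\<bar>t\<bar>}" for s
  proof -
    have "\<bar>u s \<bullet> (C s *v u s)\<bar> \<le> norm (u s) * norm (C s *v u s)"
      by (rule Cauchy_Schwarz_ineq2)
    also have "\<dots> \<le> norm (u s) * (K * norm (u s))"
      by (intro mult_left_mono K(2) that) auto
    finally show ?thesis by (simp add: dot_square_norm power2_eq_square ac_simps)
  qed
  have "u t \<bullet> u t \<le> 0"
  proof (cases "0 \<le> t")
    case True
    have "E (- 2 * K) t \<le> E (- 2 * K) 0"
    proof (rule DERIV_nonpos_imp_nonincreasing[OF True])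
      fix s assume "0 \<le> s" "s \<le> t"
      then have "- 2 * K * (u s \<bullet> u s) + 2 * (u s \<bullet> (C s *v u s)) \<le> 0"
        using inner[of s] by auto
      then show "\<exists>y. (E (- 2 * K) has_real_derivative y) (at s) \<and> y \<le> 0"
        using E[of "- 2 * K" s] by (meson exp_ge_zero mult_nonneg_nonpos)
    qed
    then show ?thesis by (simp add: E_def u(2) mult_le_0_iff)
  next
    case False
    have "E (2 * K) t \<le> E (2 * K) 0"
    proof (rule DERIV_nonneg_imp_nondecreasing[of t 0 "E (2 * K)"])
      fix s assume "t \<le> s" "s \<le> 0"
      then have "0 \<le> 2 * K * (u s \<bullet> u s) + 2 * (u s \<bullet> (C s *v u s))"
        using inner[of s] by auto
      then show "\<exists>y. (E (2 * K) has_real_derivative y) (at s) \<and> 0 \<le> y"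
        using E[of "2 * K" s] by (meson exp_ge_zero mult_nonneg_nonneg)
    qed (use False in simp)
    then show ?thesis by (simp add: E_def u(2) mult_le_0_iff)
  qed
  then have "u t \<bullet> u t = 0" by (intro antisym) auto
  then show ?thesis by simp
qed

lemma linear_ode_solution_unique:
  fixes C :: "real \<Rightarrow> real ^ 'n ^ 'n"
  assumes "continuous_on UNIV C"
    and "linear_ode_solution C u" "linear_ode_solution C v" "u 0 = v 0"
  shows "u = v"
proof
  fix t
  have "linear_ode_solution C (\<lambda>t. u t - v t)"
    using assms(2,3) unfolding linear_ode_solution_def
    by (auto simp: matrix_vector_mult_diff_distrib intro: has_vector_derivative_diff)
  then show "u t = v t"
    using linear_ode_solution_zero[OF assms(1), of "\<lambda>t. u t - v t" t] assms(4) by simp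
qed

text \<open>The columns of the transition matrix are defined by solutions starting at basis vectors. Existence
  and uniqueness make the solution a linear function of its initial value, which carries the
  description over to all solutions.\<close>

lemma transition_matrix_works:
  fixes C :: "real \<Rightarrow> real ^ 'n ^ 'n"
  assumes C: "continuous_on UNIV C" and u: "linear_ode_solution C u"
  shows "transition_matrix C t 0 *v u 0 = u t"
proof -
  define \<phi> where "\<phi> x = (THE u. linear_ode_solution C u \<and> u 0 = x)" for x
  have eq: "\<phi> (v 0) = v" if "linear_ode_solution C v" for v
    unfolding \<phi>_def using that linear_ode_solution_unique[OF C] by (intro the_equality) auto
  have sol: "linear_ode_solution C (\<phi> x)" "\<phi> x 0 = x" for x
    using linear_ode_solution_exists[OF C, of x] eq by auto
  have "linear (\<lambda>x. \<phi> x t)"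
  proof (rule linearI)
    fix x y :: "real ^ 'n" and c :: real
    have "linear_ode_solution C (\<lambda>s. \<phi> x s + \<phi> y s)"
      using sol(1)[of x] sol(1)[of y] unfolding linear_ode_solution_def
      by (auto simp: matrix_vector_right_distrib intro: has_vector_derivative_add)
    from eq[OF this] show "\<phi> (x + y) t = \<phi> x t + \<phi> y t" by (simp add: sol(2))
    have "linear_ode_solution C (\<lambda>s. c *\<^sub>R \<phi> x s)"
      using sol(1)[of x] unfolding linear_ode_solution_def
      by (auto simp: matrix_vector_mult_scaleR intro: bounded_linear.has_vector_derivative[OF bounded_linear_scaleR_right])
    from eq[OF this] show "\<phi> (c *\<^sub>R x) t = c *\<^sub>R \<phi> x t" by (simp add: sol(2))
  qed
  then have "transition_matrix C t 0 *v u 0 = \<phi> (u 0) t"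
    unfolding transition_matrix_def \<phi>_def
    by (subst matrix_works) (simp_all add: linear_matrix_vector_mul_eq)
  then show ?thesis by (simp add: eq[OF u])
qed

section \<open>Comparison for cooperative systems\<close>

text \<open>Kamke's comparison principle. Let \<open>K\<close> exceed all row sums of \<open>C\<close>. The perturbation
  \<open>z = w + e exp(K t) 1\<close> is positive at time \<open>0\<close> and satisfies the strict inequality \<open>z' > C z\<close>. If a component
  \<open>k\<close> of \<open>z\<close> vanished for the first time at \<open>\<tau>\<close>, then \<open>(C z)\<^sub>k\<close> would be a sum of nonnegative
  off-diagonal contributions there, so \<open>z\<^sub>k\<close> would be strictly increasing through \<open>0\<close>, although it is
  positive before \<open>\<tau>\<close>. The claim follows as \<open>e\<close> tends to \<open>0\<close>.\<close>

lemma differential_inequality_nonneg: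
  fixes C :: "real \<Rightarrow> real ^ 'n ^ 'n"
  assumes C: "continuous_on {0..T} C"
    and off: "\<And>t i j. t \<in> {0..T} \<Longrightarrow> i \<noteq> j \<Longrightarrow> 0 \<le> C t $ i $ j"
    and w: "\<And>t. t \<in> {0..T} \<Longrightarrow> (w has_vector_derivative w' t) (at t)"
    and w': "\<And>t. t \<in> {0..T} \<Longrightarrow> C t *v w t \<le> w' t"
    and w0: "0 \<le> w 0"
    and t: "t \<in> {0..T}"
  shows "0 \<le> w t"
proof -
  have "bounded ((\<lambda>t. C t *v 1) ` {0..T})"
    by (intro compact_imp_bounded compact_continuous_image continuous_on_mult_vec C) auto
  then obtain K0 where K0: "\<And>t. t \<in> {0..T} \<Longrightarrow> norm (C t *v 1) \<le> K0"
    unfolding bounded_iff ball_simps by metis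
  define K where "K = K0 + 1"
  have K: "(C t *v 1) $ i < K" if "t \<in> {0..T}" for t i
    using K0[OF that] component_le_norm_cart[of "C t *v 1" i] by (simp add: K_def)
  have pos: "0 < w t $ i + e * exp (K * t)" if e: "0 < e" and t: "t \<in> {0..T}" for e t i
  proof (rule ccontr)
    define z where "z s = w s + (e * exp (K * s)) *\<^sub>R 1" for s
    define z' where "z' s = w' s + (e * (K * exp (K * s))) *\<^sub>R 1" for s
    have z: "(z has_vector_derivative z' s) (at s)" if "s \<in> {0..T}" for s
    proof -
      have "((\<lambda>s. e * exp (K * s)) has_vector_derivative e * (K * exp (K * s))) (at s)"
        unfolding has_real_derivative_iff_has_vector_derivative[symmetric]
        by (auto intro!: derivative_eq_intros)
      then show ?thesis
        unfolding z_def z'_def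
        by (intro has_vector_derivative_add w that bounded_linear.has_vector_derivative[OF bounded_linear_scaleR_left])
    qed
    have zi: "((\<lambda>s. z s $ i) has_real_derivative z' s $ i) (at s)" if "s \<in> {0..T}" for s i
      using bounded_linear.has_vector_derivative[OF bounded_linear_vec_nth z[OF that]]
      by (simp add: has_real_derivative_iff_has_vector_derivative)
    assume "\<not> 0 < w t $ i + e * exp (K * t)"
    then have ti: "z t $ i \<le> 0" by (simp add: z_def)
    define A where "A = (\<Union>i. {s \<in> {0..T}. z s $ i \<le> 0})"
    have "closed {s \<in> {0..T}. z s $ i \<le> 0}" for i
      using DERIV_isCont[OF zi]
      by (intro continuous_on_closed_Collect_le continuous_at_imp_continuous_on) auto
    then have "closed A" unfolding A_def by (intro closed_UN) auto
    moreover have "A = A \<inter> {0..T}" by (auto simp: A_def)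
    ultimately have "compact A" by (metis compact_Icc closed_Int_compact)
    moreover have "A \<noteq> {}" using t ti by (auto simp: A_def)
    ultimately obtain \<tau> where \<tau>: "\<tau> \<in> A" "\<And>s. s \<in> A \<Longrightarrow> \<tau> \<le> s"
      using compact_attains_inf[of A] by blast
    then obtain k where k: "\<tau> \<in> {0..T}" "z \<tau> $ k \<le> 0" by (auto simp: A_def)
    have before: "0 < z s $ j" if "0 \<le> s" "s < \<tau>" for s j
      using \<tau>(2)[of s] that k(1) by (force simp: A_def not_le)
    have "0 < z 0 $ j" for j using w0 e by (simp add: z_def less_eq_vec_def add_nonneg_pos)
    then have "0 < \<tau>" using k by (cases "\<tau> = 0") (auto simp: not_less[symmetric])
    have at: "0 \<le> z \<tau> $ j" for j
    proof (rule tendsto_lowerbound)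
      show "((\<lambda>s. z s $ j) \<longlongrightarrow> z \<tau> $ j) (at_left \<tau>)"
        using DERIV_isCont[OF zi[OF k(1)]] by (simp add: isCont_def filterlim_at_split)
      show "\<forall>\<^sub>F s in at_left \<tau>. 0 \<le> z s $ j"
        using eventually_at_left_real[OF \<open>0 < \<tau>\<close>] by eventually_elim (auto intro: less_imp_le before)
    qed simp
    then have zk: "z \<tau> $ k = 0" using k(2) by (simp add: antisym)
    have "0 \<le> C \<tau> $ k $ j * z \<tau> $ j" for j
      using off[OF k(1), of k j] at[of j] zk by (cases "j = k") auto
    then have "0 \<le> (C \<tau> *v z \<tau>) $ k" by (simp add: mult_vec_component sum_nonneg)
    also have "\<dots> = (C \<tau> *v w \<tau>) $ k + e * exp (K * \<tau>) * (C \<tau> *v 1) $ k"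
      by (simp add: z_def matrix_vector_right_distrib matrix_vector_mult_scaleR)
    also have "\<dots> < w' \<tau> $ k + e * exp (K * \<tau>) * K"
      using w'[OF k(1)] K[OF k(1), of k] e
      by (intro add_le_less_mono mult_strict_left_mono) (auto simp: less_eq_vec_def)
    also have "\<dots> = z' \<tau> $ k" by (simp add: z'_def)
    finally obtain d where d: "0 < d" "\<And>h. 0 < h \<Longrightarrow> h < d \<Longrightarrow> z (\<tau> - h) $ k < z \<tau> $ k"
      using DERIV_pos_inc_left[OF zi[OF k(1)]] by blast
    define h where "h = min (d / 2) \<tau>"
    have "0 < h" "h < d" "h \<le> \<tau>" using d(1) \<open>0 < \<tau>\<close> by (auto simp: h_def)
    then show False using d(2)[of h] before[of "\<tau> - h" k] zk by auto
  qed
  have "0 \<le> w t $ i" for i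
  proof (rule field_le_epsilon)
    fix e :: real assume "0 < e"
    then have "0 < w t $ i + (e / exp (K * t)) * exp (K * t)" by (intro pos t) simp
    then show "0 \<le> w t $ i + e" by simp
  qed
  then show ?thesis by (simp add: less_eq_vec_def)
qed

lemma linear_ode_solution_nonneg:
  fixes C :: "real \<Rightarrow> real ^ 'n ^ 'n"
  assumes "continuous_on UNIV C" "\<And>t. positive_off_diagonal (C t)"
    and "linear_ode_solution C u" "0 \<le> u 0" "0 \<le> t"
  shows "0 \<le> u t"
proof (rule differential_inequality_nonneg[where T = t and C = C and w' = "\<lambda>t. C t *v u t"])
  show "continuous_on {0..t} C" using assms(1) continuous_on_subset by blast
qed (use assms in \<open>auto simp: positive_off_diagonal_def linear_ode_solution_def less_imp_le\<close>)

lemma exp_solution_derivative: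
  "((\<lambda>t. exp (m * t) *\<^sub>R x) has_vector_derivative exp (m * t) *\<^sub>R (m *\<^sub>R x)) (at t)"
proof -
  have "((\<lambda>t. exp (m * t)) has_vector_derivative exp (m * t) * m) (at t)"
    unfolding has_real_derivative_iff_has_vector_derivative[symmetric]
    by (auto intro!: derivative_eq_intros)
  from bounded_linear.has_vector_derivative[OF bounded_linear_scaleR_left this]
  show ?thesis by simp
qed

text \<open>The curve \<open>e\<^sup>m\<^sup>t u(0)\<close> is a subsolution, so its difference to the solution satisfies the
  hypotheses of the comparison principle.\<close>

lemma exp_le_solution:
  fixes C :: "real \<Rightarrow> real ^ 'n ^ 'n"
  assumes C: "continuous_on UNIV C" "\<And>t. positive_off_diagonal (C t)"
    and u: "linear_ode_solution C u"
    and m: "\<And>t. t \<in> {0..T} \<Longrightarrow> m *\<^sub>R u 0 \<le> C t *v u 0"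
    and t: "t \<in> {0..T}"
  shows "exp (m * t) *\<^sub>R u 0 \<le> u t"
proof -
  define w where "w t = u t - exp (m * t) *\<^sub>R u 0" for t
  define w' where "w' t = C t *v u t - exp (m * t) *\<^sub>R (m *\<^sub>R u 0)" for t
  have "0 \<le> w t"
  proof (rule differential_inequality_nonneg[OF _ _ _ _ _ t])
    show "continuous_on {0..T} C" using C(1) continuous_on_subset by blast
    show "0 \<le> C t $ i $ j" if "i \<noteq> j" for t i j
      using C(2)[of t] that by (simp add: positive_off_diagonal_def less_imp_le)
    show "(w has_vector_derivative w' t) (at t)" for t
      using u unfolding w_def w'_def linear_ode_solution_def
      by (intro has_vector_derivative_diff exp_solution_derivative) auto
    show "C t *v w t \<le> w' t" if "t \<in> {0..T}" for t
      using m[OF that] by (simp add: w_def w'_def matrix_vector_mult_diff_distrib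
          matrix_vector_mult_scaleR less_eq_vec_def)
  qed (simp add: w_def)
  then show ?thesis by (simp add: w_def)
qed

lemma solution_le_exp:
  fixes C :: "real \<Rightarrow> real ^ 'n ^ 'n"
  assumes C: "continuous_on UNIV C" "\<And>t. positive_off_diagonal (C t)"
    and u: "linear_ode_solution C u"
    and m: "\<And>t. t \<in> {0..T} \<Longrightarrow> C t *v u 0 \<le> m *\<^sub>R u 0"
    and t: "t \<in> {0..T}"
  shows "u t \<le> exp (m * t) *\<^sub>R u 0"
proof -
  have neg: "M *v (- x) = - (M *v x)" for M :: "real ^ 'n ^ 'n" and x
    using matrix_vector_mult_diff_distrib[of M 0 x] by simp
  have "linear_ode_solution C (\<lambda>t. - u t)"
    using u unfolding linear_ode_solution_def by (auto simp: neg intro: has_vector_derivative_minus)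
  from exp_le_solution[OF C this _ t, of m] m
  have "exp (m * t) *\<^sub>R - u 0 \<le> - u t" by (simp add: neg less_eq_vec_def)
  then show ?thesis by (simp add: less_eq_vec_def)
qed

text \<open>With \<open>K\<close> so large that \<open>C + K\<close> has nonnegative diagonal, every component of \<open>e\<^sup>K\<^sup>t u\<close> is nondecreasing
  along a nonnegative solution. Hence a component \<open>k\<close> that is positive initially stays positive, and
  it feeds every other component \<open>i\<close> through the positive entry \<open>c\<^sub>i\<^sub>k\<close>, which makes \<open>e\<^sup>K\<^sup>t u\<^sub>i\<close>
  strictly increasing.\<close>

lemma transition_matrix_strongly_positive:
  fixes C :: "real \<Rightarrow> real ^ 'n ^ 'n"
  assumes C: "continuous_on UNIV C" "\<And>t. positive_off_diagonal (C t)" and T: "0 < T"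
  shows "strongly_positive (transition_matrix C T 0)"
  unfolding strongly_positive_def
proof (intro allI impI)
  fix x :: "real ^ 'n" and i assume x: "0 \<le> x" "x \<noteq> 0"
  obtain u where u: "linear_ode_solution C u" "u 0 = x"
    using linear_ode_solution_exists[OF C(1)] by blast
  have nonneg: "0 \<le> u t $ j" if "0 \<le> t" for t j
    using linear_ode_solution_nonneg[OF C u(1) _ that] x(1) u(2) by (simp add: less_eq_vec_def)
  have "continuous_on {0..T} C" using C(1) continuous_on_subset by blast
  then obtain K where K: "\<And>t y. t \<in> {0..T} \<Longrightarrow> norm (C t *v y) \<le> K * norm y"
    using mult_vec_bounded_on_interval by metis
  have diag: "- K \<le> C t $ j $ j" if "t \<in> {0..T}" for t j
  proof -
    have "\<bar>(C t *v axis j 1) $ j\<bar> \<le> norm (C t *v axis j 1)" by (rule component_le_norm_cart)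
    also have "\<dots> \<le> K" using K[OF that, of "axis j 1"] by simp
    finally show ?thesis by (simp add: matrix_vector_mult_basis column_def)
  qed
  define f where "f j t = exp (K * t) * u t $ j" for j t
  have f: "(f j has_real_derivative exp (K * t) * (K * u t $ j + (C t *v u t) $ j)) (at t)" for j t
  proof -
    have "(u has_vector_derivative C t *v u t) (at t)"
      using u(1) by (simp add: linear_ode_solution_def)
    from bounded_linear.has_vector_derivative[OF bounded_linear_vec_nth this]
    have "((\<lambda>t. u t $ j) has_real_derivative (C t *v u t) $ j) (at t)"
      by (simp add: has_real_derivative_iff_has_vector_derivative)
    then show ?thesis unfolding f_def by (auto intro!: derivative_eq_intros simp: algebra_simps)
  qed
  have rate: "(\<Sum>l\<in>UNIV - {j}. C t $ j $ l * u t $ l) \<le> K * u t $ j + (C t *v u t) $ j"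
    if "t \<in> {0..T}" for t j
  proof -
    have "(C t *v u t) $ j = C t $ j $ j * u t $ j + (\<Sum>l\<in>UNIV - {j}. C t $ j $ l * u t $ l)"
      by (simp add: mult_vec_component sum.remove)
    moreover have "0 \<le> (K + C t $ j $ j) * u t $ j"
      using diag[OF that, of j] nonneg[of t j] that by (intro mult_nonneg_nonneg) auto
    ultimately show ?thesis by (simp add: algebra_simps)
  qed
  have term_nonneg: "0 \<le> C t $ j $ l * u t $ l" if "t \<in> {0..T}" "l \<noteq> j" for t j l
    using C(2)[of t] nonneg[of t l] that
    by (intro mult_nonneg_nonneg) (auto simp: positive_off_diagonal_def less_imp_le)
  obtain k where "x $ k \<noteq> 0" using x(2) by (auto simp: vec_eq_iff)
  then have k: "0 < x $ k" using x(1) by (simp add: less_eq_vec_def order_less_le)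
  have fk: "f k 0 \<le> f k t" if t: "t \<in> {0..T}" for t
  proof (rule DERIV_nonneg_imp_nondecreasing[of 0 t "f k"])
    fix s assume "0 \<le> s" "s \<le> t"
    then have s: "s \<in> {0..T}" using t by simp
    have "0 \<le> (\<Sum>l\<in>UNIV - {k}. C s $ k $ l * u s $ l)"
      using term_nonneg[OF s] by (intro sum_nonneg) auto
    then have "0 \<le> K * u s $ k + (C s *v u s) $ k" using rate[OF s, of k] by linarith
    then show "\<exists>y. (f k has_real_derivative y) (at s) \<and> 0 \<le> y"
      using f[of k s] by (meson exp_ge_zero mult_nonneg_nonneg)
  qed (use t in simp)
  have uk: "0 < u t $ k" if "t \<in> {0..T}" for t
  proof -
    have "0 < f k t" using fk[OF that] k u(2) by (simp add: f_def)
    then show ?thesis by (simp add: f_def zero_less_mult_iff)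
  qed
  have "0 < u T $ i"
  proof (cases "i = k")
    case True
    then show ?thesis using uk[of T] T by simp
  next
    case False
    have "f i 0 < f i T"
    proof (rule DERIV_pos_imp_increasing[OF T])
      fix s assume "0 \<le> s" "s \<le> T"
      then have s: "s \<in> {0..T}" by simp
      have "0 < C s $ i $ k * u s $ k"
        using C(2)[of s] uk[OF s] False by (simp add: positive_off_diagonal_def)
      then have "0 < (\<Sum>l\<in>UNIV - {i}. C s $ i $ l * u s $ l)"
        using term_nonneg[OF s] False by (intro sum_pos2[of _ k]) auto
      then have "0 < K * u s $ i + (C s *v u s) $ i" using rate[OF s, of i] by linarith
      then show "\<exists>y. (f i has_real_derivative y) (at s) \<and> 0 < y"
        using f[of i s] by (meson exp_gt_zero mult_pos_pos)
    qed
    moreover have "0 \<le> f i 0" using nonneg[of 0 i] by (simp add: f_def)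
    ultimately have "0 < f i T" by linarith
    then show ?thesis by (simp add: f_def zero_less_mult_iff)
  qed
  then show "0 < (transition_matrix C T 0 *v x) $ i"
    using transition_matrix_works[OF C(1) u(1), of T] u(2) by simp
qed

section \<open>Extremal matrices and the bounds for the exponent\<close>

lemma C_min_C_max:
  fixes C :: "real \<Rightarrow> real ^ 'n ^ 'n"
  assumes C: "continuous_on UNIV C" and T: "0 \<le> T"
  shows C_min_attained: "\<exists>t\<in>{0..T}. C_min C T $ i $ j = C t $ i $ j"
    and C_max_attained: "\<exists>t\<in>{0..T}. C_max C T $ i $ j = C t $ i $ j"
    and C_min_le: "t \<in> {0..T} \<Longrightarrow> C_min C T $ i $ j \<le> C t $ i $ j"
    and C_le_max: "t \<in> {0..T} \<Longrightarrow> C t $ i $ j \<le> C_max C T $ i $ j"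
proof -
  have cont: "continuous_on {0..T} (\<lambda>t. C t $ i $ j)"
    using continuous_on_subset[OF C, of "{0..T}"] by (intro continuous_intros) auto
  have ne: "{0..T} \<noteq> {}" using T by simp
  obtain a where a: "a \<in> {0..T}" "\<And>t. t \<in> {0..T} \<Longrightarrow> C a $ i $ j \<le> C t $ i $ j"
    using continuous_attains_inf[OF compact_Icc ne cont] by blast
  obtain b where b: "b \<in> {0..T}" "\<And>t. t \<in> {0..T} \<Longrightarrow> C t $ i $ j \<le> C b $ i $ j"
    using continuous_attains_sup[OF compact_Icc ne cont] by blast
  have mn: "C_min C T $ i $ j = C a $ i $ j"
    unfolding C_min_def using a by (auto intro!: Least_equality)
  have mx: "C_max C T $ i $ j = C b $ i $ j"
    unfolding C_max_def using b by (auto intro!: Greatest_equality)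
  show "\<exists>t\<in>{0..T}. C_min C T $ i $ j = C t $ i $ j" using mn a(1) by blast
  show "\<exists>t\<in>{0..T}. C_max C T $ i $ j = C t $ i $ j" using mx b(1) by blast
  show "t \<in> {0..T} \<Longrightarrow> C_min C T $ i $ j \<le> C t $ i $ j" using mn a(2) by simp
  show "t \<in> {0..T} \<Longrightarrow> C t $ i $ j \<le> C_max C T $ i $ j" using mx b(2) by simp
qed

theorem mainTheorem2:
  fixes C :: "real \<Rightarrow> real ^ 'n ^ 'n" and T :: real
  assumes "T > 0"
    and "continuous_on UNIV C"
    and "\<And>t. C (t + T) = C t"
    and "\<And>t. positive_off_diagonal (C t)"
  shows "lambda_dom (C_min C T) \<le> principal_lyapunov_exponent C T \<and>
         principal_lyapunov_exponent C T \<le> lambda_dom (C_max C T)"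
proof -
  let ?P = "transition_matrix C T 0"
  note C = assms(2,4)
  have T: "T \<in> {0..T}" "0 \<le> T" using assms(1) by auto
  have P: "strongly_positive ?P"
    by (rule transition_matrix_strongly_positive[OF C assms(1)])
  then have P_nonneg: "0 \<le> ?P $ i $ j" for i j
    by (rule less_imp_le[OF strongly_positive_entry])
  obtain \<rho> y where \<rho>: "0 < \<rho>" and y: "\<And>i. 0 < y $ i" "?P *v y = \<rho> *\<^sub>R y"
    using perron_vector_exists[OF P] by metis
  have \<Lambda>: "principal_lyapunov_exponent C T = ln \<rho> / T"
    using spectral_radius_eqI[OF P_nonneg y] by (simp add: principal_lyapunov_exponent_def)
  have nonneg: "0 \<le> v" "v \<noteq> 0" if "\<And>i. 0 < v $ i" for v :: "real ^ 'n"
    using that by (auto simp: less_eq_vec_def less_imp_le)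

  define m where "m = lambda_dom (C_min C T)"
  have "positive_off_diagonal (C_min C T)"
    using C_min_attained[OF C(1) T(2)] C(2) unfolding positive_off_diagonal_def by metis
  then obtain x where x: "\<And>i. 0 < x $ i" "C_min C T *v x = m *\<^sub>R x"
    unfolding m_def using lambda_dom_eigenvector by metis
  obtain u where u: "linear_ode_solution C u" "u 0 = x"
    using linear_ode_solution_exists[OF C(1)] by blast
  have "exp (m * T) *\<^sub>R u 0 \<le> u T"
  proof (rule exp_le_solution[OF C u(1) _ T(1)])
    show "m *\<^sub>R u 0 \<le> C t *v u 0" if "t \<in> {0..T}" for t
      unfolding u(2) x(2)[symmetric] using C_min_le[OF C(1) T(2) that] x(1)
      by (auto simp: less_eq_vec_def mult_vec_component less_imp_le intro!: sum_mono mult_right_mono)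
  qed
  then have "exp (m * T) *\<^sub>R x \<le> ?P *v x"
    using transition_matrix_works[OF C(1) u(1), of T] u(2) by simp
  \<comment> \<open>Lower test vector: the Perron vector of the minimal matrix; upper test vector: that of the transition matrix.\<close>
  then have lower: "exp (m * T) \<le> \<rho>"
    using collatz_wielandt[OF P_nonneg nonneg[OF x(1)] _ y(1), of "exp (m * T)" \<rho>] y(2) by simp

  define M where "M = lambda_dom (C_max C T)"
  have "positive_off_diagonal (C_max C T)"
    using C_max_attained[OF C(1) T(2)] C(2) unfolding positive_off_diagonal_def by metis
  then obtain z where z: "\<And>i. 0 < z $ i" "C_max C T *v z = M *\<^sub>R z"
    unfolding M_def using lambda_dom_eigenvector by metis
  obtain v where v: "linear_ode_solution C v" "v 0 = z"
    using linear_ode_solution_exists[OF C(1)] by blast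
  have "v T \<le> exp (M * T) *\<^sub>R v 0"
  proof (rule solution_le_exp[OF C v(1) _ T(1)])
    show "C t *v v 0 \<le> M *\<^sub>R v 0" if "t \<in> {0..T}" for t
      unfolding v(2) z(2)[symmetric] using C_le_max[OF C(1) T(2) that] z(1)
      by (auto simp: less_eq_vec_def mult_vec_component less_imp_le intro!: sum_mono mult_right_mono)
  qed
  then have "?P *v z \<le> exp (M * T) *\<^sub>R z"
    using transition_matrix_works[OF C(1) v(1), of T] v(2) by simp
  \<comment> \<open>Now the Perron vector of the transition matrix is the lower test vector, and that of the maximal matrix the upper one.\<close>
  then have upper: "\<rho> \<le> exp (M * T)"
    using collatz_wielandt[OF P_nonneg nonneg[OF y(1)] _ z(1), of \<rho> "exp (M * T)"] y(2) by simp

  have "m * T \<le> ln \<rho>" "ln \<rho> \<le> M * T"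
    using lower upper \<rho> by (simp_all add: ln_ge_iff) (metis ln_exp ln_mono exp_gt_zero)
  then show ?thesis
    using assms(1) by (simp add: \<Lambda> m_def[symmetric] M_def[symmetric] field_simps)
qed

end
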